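(* Let $p$ be an odd prime and let $\alpha$ be a $p$-integral rational number. Then $$\binom{\alpha p-1}{p-1}\equiv 1-\alpha(\alpha-1)(\alpha^{2}-\alpha-1)\,p\sum_{k=1}^{p-1}\frac{1}{k}+\alpha^{2}(\alpha-1)^{2}p^{2}\sum_{1\le i<j\le p-1}\frac{1}{ij}\pmod{p^{m}},$$ where $m=7$ if $p\neq 7$ and $m=6$ if $p=7$.
   Context: A rational number is $p$-integral if its reduced denominator is not divisible by $p$. For $p$-integral rationals $a,b$, $a\equiv b \pmod{p^m}$ means that $(a-b)/p^m$ is $p$-integral. For a rational $x$ and an integer $n\ge 0$, $\binom{x}{n}=\frac{x(x-1)\cdots(x-n+1)}{n!}$. *)

theory Defs
  imports Complex_Main "HOL-Computational_Algebra.Primes"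
begin

definition p_integral :: "nat \<Rightarrow> rat \<Rightarrow> bool" where
  "p_integral p x \<longleftrightarrow> \<not> int p dvd snd (quotient_of x)"

text \<open>
  The congruence \<open>a \<equiv> b (mod p^m)\<close> is only meant for \<open>p\<close>-integral \<open>a\<close> and \<open>b\<close>, so their
  \<open>p\<close>-integrality is part of the definition.
\<close>

definition rat_cong_ppow :: "nat \<Rightarrow> nat \<Rightarrow> rat \<Rightarrow> rat \<Rightarrow> bool" where
  "rat_cong_ppow p m a b \<longleftrightarrow>
     p_integral p a \<and> p_integral p b \<and> p_integral p ((a - b) / of_nat p ^ m)"

end

theory Submission
  imports Defs "HOL-Computational_Algebra.Polynomial"
begin

text \<open>
  Put \<open>t = \<alpha>\<^sup>2 - \<alpha>\<close> and \<open>c k = 1 / (k (p - k))\<close>.  Pairing \<open>k\<close> with \<open>p - k\<close> in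
  \<open>\<Prod>k. (1 - \<alpha> p / k)\<close>, which is the binomial coefficient, turns it into
  \<open>\<Prod>k \<le> (p - 1) / 2. (1 + t p\<^sup>2 c k) = (\<Sum>j. t ^ j p ^ (2 j) E j)\<close> with \<open>E j\<close> the elementary
  symmetric functions of the \<open>c k\<close>.  The terms \<open>j \<le> 2\<close> are exactly the right-hand side, and the
  terms \<open>j \<ge> 4\<close> are divisible by \<open>p ^ 8\<close>.  Finally, doubling permutes \<open>{1..(p - 1) / 2}\<close> up to the
  symmetry \<open>k \<mapsto> p - k\<close> of \<open>c\<close>, and modulo \<open>p\<close> it divides \<open>c\<close> by \<open>4\<close>.  Hence
  \<open>4 ^ 3 * E 3 \<equiv> E 3\<close>, and as \<open>4 ^ 3 - 1 = 3\<^sup>2 * 7\<close>, \<open>p\<close> divides \<open>E 3\<close> unless \<open>p\<close> is \<open>3\<close> or \<open>7\<close>;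
  for \<open>p = 3\<close> there is only one factor and \<open>E 3 = 0\<close>.
\<close>

section \<open>The ring of p-integral rationals\<close>

lemma p_integral_iff:
  "p_integral p x \<longleftrightarrow> (\<exists>a b. \<not> int p dvd b \<and> x = of_int a / of_int b)"
proof
  assume "p_integral p x"
  moreover obtain m n where mn: "quotient_of x = (m, n)"
    by fastforce
  ultimately show "\<exists>a b. \<not> int p dvd b \<and> x = of_int a / of_int b"
    using quotient_of_div[OF mn] by (auto simp: p_integral_def)
next
  assume "\<exists>a b. \<not> int p dvd b \<and> x = of_int a / of_int b"
  then obtain a b where ab: "\<not> int p dvd b" "x = of_int a / of_int b"
    by blast
  obtain m n where mn: "quotient_of x = (m, n)"
    by fastforce
  have nz: "n \<noteq> 0" "b \<noteq> 0"
    using quotient_of_denom_pos[OF mn] ab by auto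
  have "of_int m / of_int n = (of_int a / of_int b :: rat)"
    using quotient_of_div[OF mn] ab by simp
  \<comment> \<open>Cross-multiplying and cancelling \<open>m\<close>, which is coprime to
    \<open>n\<close>, shows that the reduced denominator \<open>n\<close> divides any other
    denominator \<open>b\<close>.\<close>
  then have "of_int (m * b) = (of_int (a * n) :: rat)"
    using nz by (simp add: field_simps)
  then have "n dvd m * b"
    by (simp only: of_int_eq_iff dvd_triv_right)
  then have "n dvd b"
    using quotient_of_coprime[OF mn] by (simp add: coprime_commute coprime_dvd_mult_right_iff)
  then show "p_integral p x"
    using ab mn by (auto simp: p_integral_def dest: dvd_trans)
qed

lemma p_integral_divide:
  assumes "prime p" "p_integral p x" "\<not> int p dvd b"
  shows "p_integral p (x / of_int b)"
proof -
  obtain a d where "\<not> int p dvd d" "x = of_int a / of_int d"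
    using assms p_integral_iff by blast
  then show ?thesis
    using assms unfolding p_integral_iff
    by (intro exI[of _ a] exI[of _ "d * b"]) (simp add: prime_dvd_mult_iff)
qed

context
  fixes p :: nat
  assumes prime: "prime p"
begin

lemma p_integral_of_int: "p_integral p (of_int a)"
  unfolding p_integral_iff using prime
  by (intro exI[of _ a] exI[of _ 1]) (auto simp: prime_nat_iff)

lemma p_integral_0: "p_integral p 0"
  using p_integral_of_int[of 0] by simp

lemma p_integral_1: "p_integral p 1"
  using p_integral_of_int[of 1] by simp

lemma p_integral_of_nat: "p_integral p (of_nat a)"
  using p_integral_of_int[of "int a"] by simp

lemma p_integral_numeral: "p_integral p (numeral n)"
  using p_integral_of_int[of "numeral n"] by simp

lemma p_integral_add:
  assumes "p_integral p x" "p_integral p y"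
  shows "p_integral p (x + y)"
proof -
  obtain a b c d where *: "\<not> int p dvd b" "x = of_int a / of_int b"
    "\<not> int p dvd d" "y = of_int c / of_int d"
    using assms p_integral_iff by meson
  then have "b \<noteq> 0" "d \<noteq> 0"
    by auto
  with * prime show ?thesis
    unfolding p_integral_iff
    by (intro exI[of _ "a * d + c * b"] exI[of _ "b * d"]) (simp add: prime_dvd_mult_iff field_simps)
qed

lemma p_integral_mult:
  assumes "p_integral p x" "p_integral p y"
  shows "p_integral p (x * y)"
proof -
  obtain a b c d where "\<not> int p dvd b" "x = of_int a / of_int b"
    "\<not> int p dvd d" "y = of_int c / of_int d"
    using assms p_integral_iff by meson
  with prime show ?thesis
    unfolding p_integral_iff
    by (intro exI[of _ "a * c"] exI[of _ "b * d"]) (simp add: prime_dvd_mult_iff)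
qed

lemma p_integral_minus: "p_integral p x \<Longrightarrow> p_integral p (- x)"
  using p_integral_mult[OF p_integral_of_int[of "-1"]] by simp

lemma p_integral_diff: "p_integral p x \<Longrightarrow> p_integral p y \<Longrightarrow> p_integral p (x - y)"
  using p_integral_add[OF _ p_integral_minus] by force

lemma p_integral_power: "p_integral p x \<Longrightarrow> p_integral p (x ^ n)"
  by (induction n) (auto intro: p_integral_mult p_integral_1)

lemmas p_integral_intros =
  p_integral_0 p_integral_1 p_integral_of_nat p_integral_numeral p_integral_add p_integral_mult
  p_integral_minus p_integral_diff p_integral_power

lemma p_integral_sum: "(\<And>k. k \<in> A \<Longrightarrow> p_integral p (f k)) \<Longrightarrow> p_integral p (sum f A)"
  by (induction A rule: infinite_finite_induct) (auto intro: p_integral_intros)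

lemma p_integral_poly:
  "(\<And>n. p_integral p (coeff q n)) \<Longrightarrow> p_integral p x \<Longrightarrow> p_integral p (poly q x)"
  unfolding poly_altdef by (intro p_integral_sum p_integral_intros)

end

section \<open>Elementary symmetric functions as coefficients of products of linear
  polynomials\<close>

lemma coeff_linear_mult:
  fixes a :: "'a::comm_semiring_1"
  shows "coeff ([:1, a:] * q) 0 = coeff q 0"
    and "coeff ([:1, a:] * q) (Suc n) = coeff q (Suc n) + a * coeff q n"
  by simp_all

lemma coeff_0_prod_linear: "coeff (\<Prod>k\<in>A. [:1, c k:]) 0 = (1 :: 'a::comm_semiring_1)"
  by (induction A rule: infinite_finite_induct) (simp_all add: coeff_linear_mult)

lemma coeff_1_prod_linear:
  fixes c :: "'b \<Rightarrow> 'a::comm_semiring_1"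
  assumes "finite A"
  shows "coeff (\<Prod>k\<in>A. [:1, c k:]) (Suc 0) = sum c A"
  using assms
  by induction
    (simp_all add: coeff_linear_mult coeff_0_prod_linear add.commute del: mult_pCons_left)

text \<open>Newton's identity for the second elementary symmetric function, doubled because a
  commutative ring need not allow halving.\<close>

lemma coeff_2_prod_linear:
  fixes c :: "'b \<Rightarrow> 'a::comm_ring_1"
  assumes "finite A"
  shows "2 * coeff (\<Prod>k\<in>A. [:1, c k:]) (Suc (Suc 0)) = (sum c A)\<^sup>2 - (\<Sum>k\<in>A. (c k)\<^sup>2)"
  using assms
  by induction
    (simp_all add: coeff_linear_mult coeff_1_prod_linear power2_eq_square algebra_simps
      del: mult_pCons_left)

text \<open>The \<open>n\<close>-th elementary symmetric function is homogeneous of degree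
  \<open>n\<close>.\<close>

lemma coeff_prod_linear_scale:
  fixes c :: "'b \<Rightarrow> 'a::comm_semiring_1"
  shows "coeff (\<Prod>k\<in>A. [:1, a * c k:]) n = a ^ n * coeff (\<Prod>k\<in>A. [:1, c k:]) n"
proof (induction A arbitrary: n rule: infinite_finite_induct)
  case (insert x A)
  then show ?case
    by (cases n)
      (simp_all add: coeff_linear_mult coeff_0_prod_linear algebra_simps
        del: mult_pCons_left)
qed (simp_all add: coeff_1)

context
  fixes p :: nat
  assumes prime: "prime p"
begin

lemma p_integral_coeff_prod_linear:
  assumes "\<And>k. k \<in> A \<Longrightarrow> p_integral p (c k)"
  shows "p_integral p (coeff (\<Prod>k\<in>A. [:1, c k:]) n)"
  using assms
proof (induction A arbitrary: n rule: infinite_finite_induct)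
  case (insert x A)
  then show ?case
    by (cases n)
      (auto simp: coeff_linear_mult coeff_0_prod_linear
        simp del: mult_pCons_left intro!: p_integral_intros[OF prime])
qed (auto simp: coeff_1 intro: p_integral_intros[OF prime])

lemma coeff_prod_linear_cong:
  assumes "\<And>k. k \<in> A \<Longrightarrow> p_integral p (c k)" "\<And>k. k \<in> A \<Longrightarrow> p_integral p (d k)"
    and "\<And>k. k \<in> A \<Longrightarrow> p_integral p ((d k - c k) / of_nat p)"
  shows "p_integral p
    ((coeff (\<Prod>k\<in>A. [:1, d k:]) n - coeff (\<Prod>k\<in>A. [:1, c k:]) n) / of_nat p)"
  using assms
proof (induction A arbitrary: n rule: infinite_finite_induct)
  case (insert x A)
  let ?C = "coeff (\<Prod>k\<in>A. [:1, c k:])" and ?D = "coeff (\<Prod>k\<in>A. [:1, d k:])"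
  have IH: "p_integral p ((?D n - ?C n) / of_nat p)" for n
    using insert by simp
  show ?case
  proof (cases n)
    case 0
    then show ?thesis
      by (simp only: coeff_0_prod_linear) (simp add: p_integral_intros[OF prime])
  next
    case (Suc m)
    \<comment> \<open>Writing \<open>d x * ?D m - c x * ?C m\<close> as
      \<open>d x * (?D m - ?C m) + (d x - c x) * ?C m\<close> leaves in every summand a difference
      already known to be divisible by \<open>p\<close>.\<close>
    have "p_integral p ((?D n - ?C n) / of_nat p + d x * ((?D m - ?C m) / of_nat p)
        + (d x - c x) / of_nat p * ?C m)"
      using insert IH p_integral_coeff_prod_linear[of A c]
      by (intro p_integral_intros[OF prime]) auto
    also have "(?D n - ?C n) / of_nat p + d x * ((?D m - ?C m) / of_nat p)
        + (d x - c x) / of_nat p * ?C m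
      = ((?D n + d x * ?D m) - (?C n + c x * ?C m)) / of_nat p"
      by (simp add: diff_divide_distrib add_divide_distrib algebra_simps)
    finally show ?thesis
      using insert(1,2) by (simp add: Suc coeff_linear_mult del: mult_pCons_left)
  qed
qed (auto simp: p_integral_intros[OF prime])

text \<open>Cuts the expansion after degree three. At \<open>y = t * p^2\<close> the tail
  \<open>y ^ 4 * r\<close> is a multiple of \<open>p ^ 8\<close>.\<close>

lemma poly_remainder_4:
  assumes "\<And>n. p_integral p (coeff q n)" "p_integral p y"
  shows "\<exists>r. p_integral p r \<and> poly q y = coeff q 0 + y * coeff q (Suc 0)
    + y\<^sup>2 * coeff q (Suc (Suc 0)) + y ^ 3 * coeff q (Suc (Suc (Suc 0))) + y ^ 4 * r"
proof -
  obtain a b c d s where q: "q = pCons a (pCons b (pCons c (pCons d s)))"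
    by (metis pCons_cases)
  have "p_integral p (coeff s n)" for n
    using assms(1)[of "Suc (Suc (Suc (Suc n)))"] by (simp add: q)
  then have "p_integral p (poly s y)"
    using assms(2) p_integral_poly[OF prime] by blast
  then show ?thesis
    by (intro exI[of _ "poly s y"]) (simp add: q algebra_simps eval_nat_numeral)
qed

end

section \<open>Sums over pairs, reflection of ranges, and the binomial coefficient as a
  product\<close>

lemma sum_pairs_less:
  fixes f :: "nat \<Rightarrow> 'a::comm_ring_1"
  shows "2 * (\<Sum>(i, j) \<in> {(i, j). 1 \<le> i \<and> i < j \<and> j \<le> n}. f i * f j)
    = (\<Sum>k = 1..n. f k)\<^sup>2 - (\<Sum>k = 1..n. (f k)\<^sup>2)"
proof -
  \<comment> \<open>With the larger index outermost, passing from \<open>n\<close> to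
    \<open>Suc n\<close> adds just one inner sum.\<close>
  have "{(i, j). 1 \<le> i \<and> i < j \<and> j \<le> n} = prod.swap ` (SIGMA j : {1..n}. {1..<j})"
    by (auto simp: image_iff)
  then have "(\<Sum>(i, j) \<in> {(i, j). 1 \<le> i \<and> i < j \<and> j \<le> n}. f i * f j)
    = (\<Sum>(j, i) \<in> (SIGMA j : {1..n}. {1..<j}). f i * f j)"
    by (simp add: sum.reindex case_prod_unfold)
  also have "\<dots> = (\<Sum>j = 1..n. \<Sum>i = 1..<j. f i * f j)"
    by (simp add: sum.Sigma)
  also have "2 * \<dots> = (\<Sum>k = 1..n. f k)\<^sup>2 - (\<Sum>k = 1..n. (f k)\<^sup>2)"
    by (induction n)
      (simp_all add: atLeastLessThanSuc_atLeastAtMost sum_distrib_right[symmetric]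
        power2_eq_square algebra_simps)
  finally show ?thesis .
qed

text \<open>Truncated subtraction is harmless here: \<open>k\<close> always stays below \<open>p\<close>.\<close>

definition inv_pair :: "nat \<Rightarrow> nat \<Rightarrow> rat" where
  "inv_pair p k = 1 / (of_nat k * of_nat (p - k))"

text \<open>Holds in any commutative monoid, so that one proof serves sums and products. For
  \<open>p = 2 * h + 1\<close> it pairs \<open>k\<close> with \<open>p - k\<close>.\<close>

lemma split_reflect:
  fixes g :: "nat \<Rightarrow> 'a"
  assumes "comm_monoid_set f z"
  shows "comm_monoid_set.F f z g {1..2 * h}
    = comm_monoid_set.F f z (\<lambda>k. f (g k) (g (2 * h + 1 - k))) {1..h}"
proof -
  interpret comm_monoid_set f z
    by (fact assms)
  have "{1..2 * h} = {1..h} \<union> {h + 1..2 * h}"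
    by auto
  then have "F g {1..2 * h} = f (F g {1..h}) (F g {h + 1..2 * h})"
    by (simp add: union_disjoint)
  also have "F g {h + 1..2 * h} = F (\<lambda>k. g (2 * h + 1 - k)) {1..h}"
    by (rule reindex_bij_witness[of _ "\<lambda>k. 2 * h + 1 - k" "\<lambda>k. 2 * h + 1 - k"]) auto
  finally show ?thesis
    by (simp add: distrib)
qed

lemmas sum_split_reflect = split_reflect[OF sum.comm_monoid_set_axioms, folded sum_def]
lemmas prod_split_reflect = split_reflect[OF prod.comm_monoid_set_axioms, folded prod_def]

text \<open>Each numerator factor \<open>x - k\<close> is \<open>- k * (1 - x / k)\<close>, and the
  factors \<open>k\<close> cancel against the factorial.\<close>

lemma gbinomial_pred_eq_prod:
  fixes x :: "'a::field_char_0"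
  shows "(x - 1) gchoose n = (-1) ^ n * (\<Prod>k = 1..n. 1 - x / of_nat k)"
proof (induction n)
  case (Suc n)
  have "(x - 1) gchoose Suc n = ((x - 1) gchoose n) * (x - 1 - of_nat n) / of_nat (Suc n)"
    by (simp add: gbinomial_prod_rev atLeast0_lessThan_Suc field_simps)
  also have "\<dots> = ((x - 1) gchoose n) * - (1 - x / of_nat (Suc n))"
    by (simp add: field_simps del: of_nat_Suc) (simp add: algebra_simps)
  finally show ?case
    by (simp add: Suc algebra_simps)
qed simp

section \<open>Doubling of the index and divisibility of the third symmetric function\<close>

context
  fixes p h :: nat
  assumes prime: "prime p" and p_eq: "p = 2 * h + 1"
begin

lemma not_dvd_of_less: "0 < k \<Longrightarrow> k < p \<Longrightarrow> \<not> int p dvd int k"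
  by (auto dest: dvd_imp_le)

lemma p_integral_inv_pair:
  assumes "k \<in> {1..h}"
  shows "p_integral p (inv_pair p k)"
proof -
  have "k < p"
    using assms p_eq by auto
  then have "\<not> int p dvd int (k * (p - k))"
    using not_dvd_of_less[of k] not_dvd_of_less[of "p - k"] assms prime
    by (simp add: prime_dvd_mult_iff)
  from p_integral_divide[OF prime p_integral_1[OF prime] this] show ?thesis
    by (simp add: inv_pair_def)
qed

text \<open>With \<open>u = p - 2 * k\<close> and \<open>v = p - k\<close>, the difference of
  \<open>4 / (2 * k * u)\<close> and \<open>1 / (k * v)\<close> has numerator
  \<open>2 * v - u = p\<close> over \<open>k * u * v\<close>, which is prime to
  \<open>p\<close>.\<close>

lemma four_inv_pair_double:
  assumes "k \<in> {1..h}"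
  shows "p_integral p ((4 * inv_pair p (2 * k) - inv_pair p k) / of_nat p)"
proof -
  have lt: "k < p" "2 * k < p"
    using assms p_eq by auto
  have "\<not> int p dvd int (k * (p - 2 * k) * (p - k))"
    using not_dvd_of_less[of k] not_dvd_of_less[of "p - k"] not_dvd_of_less[of "p - 2 * k"]
      assms prime lt
    by (simp add: prime_dvd_mult_iff)
  from p_integral_divide[OF prime p_integral_1[OF prime] this]
  have "p_integral p (1 / (of_nat k * of_nat (p - 2 * k) * of_nat (p - k)))"
    by simp
  moreover have "(4 * inv_pair p (2 * k) - inv_pair p k) / of_nat p
    = 1 / (of_nat k * of_nat (p - 2 * k) * of_nat (p - k))"
  proof -
    have "(4 * (1 / (2 * x * u)) - 1 / (x * v)) / y = 1 / (x * u * v)"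
      if "y = 2 * v - u" "x \<noteq> 0" "u \<noteq> 0" "v \<noteq> 0" "y \<noteq> 0" for x y u v :: rat
    proof -
      have "4 * (1 / (2 * x * u)) - 1 / (x * v) = (2 * v - u) / (x * u * v)"
        using that(2-4) by (simp add: field_simps)
      then show ?thesis
        using that by simp
    qed
    from this[of "of_nat p" "of_nat (p - k)" "of_nat (p - 2 * k)" "of_nat k"] show ?thesis
      using assms lt by (simp add: inv_pair_def of_nat_diff)
  qed
  ultimately show ?thesis
    by simp
qed

lemma inv_pair_reflect: "k < p \<Longrightarrow> inv_pair p (p - k) = inv_pair p k"
  by (simp add: inv_pair_def mult.commute)

abbreviation esym :: "nat \<Rightarrow> rat" where
  "esym n \<equiv> coeff (\<Prod>k = 1..h. [:1, inv_pair p k:]) n"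

lemma bij_betw_double: "bij_betw (\<lambda>k. if 2 * k \<le> h then 2 * k else p - 2 * k) {1..h} {1..h}"
proof -
  have "inj_on (\<lambda>k. if 2 * k \<le> h then 2 * k else p - 2 * k) {1..h}"
  proof (rule inj_onI)
    fix k l
    assume "k \<in> {1..h}" "l \<in> {1..h}"
      "(if 2 * k \<le> h then 2 * k else p - 2 * k) = (if 2 * l \<le> h then 2 * l else p - 2 * l)"
    \<comment> \<open>Parity keeps the two branches apart: \<open>p - 2 * b\<close> is odd, since
      \<open>b \<le> h\<close> prevents truncation to 0.\<close>
    moreover have "2 * a \<noteq> p - 2 * b" if "b \<le> h" for a b
      using that p_eq by simp presburger
    then have "2 * k \<noteq> p - 2 * l" "p - 2 * k \<noteq> 2 * l"
      using \<open>k \<in> {1..h}\<close> \<open>l \<in> {1..h}\<close> by (auto dest: sym)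
    ultimately show "k = l"
      using p_eq by (auto split: if_splits)
  qed
  moreover have "(\<lambda>k. if 2 * k \<le> h then 2 * k else p - 2 * k) ` {1..h} \<subseteq> {1..h}"
    using p_eq by auto
  ultimately show ?thesis
    unfolding bij_betw_def using endo_inj_surj[OF finite_atLeastAtMost] by blast
qed

text \<open>The coefficient for the values \<open>4 * inv_pair p (s k)\<close> is computed twice:
  exactly it is \<open>4 ^ n * esym n\<close>, by permutation and homogeneity; modulo
  \<open>p\<close> it is \<open>esym n\<close>, by comparing factors.\<close>

lemma esym_scale: "p_integral p ((4 ^ n - 1) * esym n / of_nat p)"
proof -
  define s where "s k = (if 2 * k \<le> h then 2 * k else p - 2 * k)" for k
  have s_in: "s k \<in> {1..h}" if "k \<in> {1..h}" for k
    using that p_eq by (auto simp: s_def)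
  have s: "inv_pair p (s k) = inv_pair p (2 * k)" if "k \<in> {1..h}" for k
    using that p_eq inv_pair_reflect[of "2 * k"] by (auto simp: s_def)
  have "(\<Prod>k = 1..h. [:1, inv_pair p (s k):]) = (\<Prod>k = 1..h. [:1, inv_pair p k:])"
    by (intro prod.reindex_bij_betw) (use bij_betw_double in \<open>simp add: s_def[abs_def]\<close>)
  moreover have "p_integral p (4 * inv_pair p (s k))" if "k \<in> {1..h}" for k
    using that by (intro p_integral_intros[OF prime] p_integral_inv_pair s_in)
  then have "p_integral p
    ((coeff (\<Prod>k = 1..h. [:1, 4 * inv_pair p (s k):]) n - esym n) / of_nat p)"
    using s four_inv_pair_double p_integral_inv_pair
    by (intro coeff_prod_linear_cong[OF prime]) simp_all
  ultimately show ?thesis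
    by (simp add: coeff_prod_linear_scale left_diff_distrib)
qed

lemma esym_3_dvd:
  assumes "p \<noteq> 7"
  shows "p_integral p (esym 3 / of_nat p)"
proof (cases "p = 3")
  case True
  then have "h = 1"
    using p_eq by simp
  then show ?thesis
    by (simp add: numeral_3_eq_3 p_integral_0[OF prime])
next
  case False
  have "\<not> p dvd 3 * 3 * 7"
    using assms False prime primes_dvd_imp_eq[of p 3] primes_dvd_imp_eq[of p 7]
    by (subst prime_dvd_mult_iff prime_dvd_mult_iff, simp)+ auto
  then have "\<not> int p dvd 63"
    using int_dvd_int_iff[of p 63] by simp
  from p_integral_divide[OF prime esym_scale[of 3] this] show ?thesis
    by simp
qed

section \<open>Both sides of the congruence in terms of the symmetric functions\<close>

lemma inverse_add_reflect:
  assumes "k \<in> {1..h}"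
  shows "1 / of_nat k + 1 / of_nat (p - k) = of_nat p * inv_pair p k"
proof -
  have "k < p" "of_nat p - of_nat k \<noteq> (0 :: rat)"
    using assms p_eq by auto
  with assms show ?thesis
    by (simp add: inv_pair_def of_nat_diff field_simps)
qed

lemma sum_inverse_eq: "(\<Sum>k = 1..p - 1. 1 / of_nat k) = of_nat p * esym 1"
proof -
  have "(\<Sum>k = 1..p - 1. 1 / of_nat k :: rat) = (\<Sum>k = 1..h. of_nat p * inv_pair p k)"
    using sum_split_reflect[of "\<lambda>k. 1 / of_nat k :: rat" h] inverse_add_reflect
    by (simp add: p_eq)
  then show ?thesis
    by (simp add: coeff_1_prod_linear sum_distrib_left)
qed

lemma sum_inverse_square_eq:
  "(\<Sum>k = 1..p - 1. (1 / of_nat k)\<^sup>2)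
    = (of_nat p)\<^sup>2 * (\<Sum>k = 1..h. (inv_pair p k)\<^sup>2) - 2 * esym 1"
proof -
  have *: "(1 / of_nat k)\<^sup>2 + (1 / of_nat (p - k))\<^sup>2 = (of_nat p)\<^sup>2 * (inv_pair p k)\<^sup>2 - 2 * inv_pair p k"
    if "k \<in> {1..h}" for k
  proof -
    \<comment> \<open>The product of the two reciprocals is \<open>inv_pair p k\<close>, which turns
      the sum of squares into a squared sum with a correction.\<close>
    have "(1 / of_nat k)\<^sup>2 + (1 / of_nat (p - k))\<^sup>2
      = (1 / of_nat k + 1 / of_nat (p - k))\<^sup>2 - 2 * inv_pair p k"
      by (simp add: inv_pair_def power2_eq_square algebra_simps)
    then show ?thesis
      using inverse_add_reflect[OF that] by (simp add: power_mult_distrib)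
  qed
  have "(\<Sum>k = 1..p - 1. (1 / of_nat k)\<^sup>2 :: rat)
    = (\<Sum>k = 1..h. (of_nat p)\<^sup>2 * (inv_pair p k)\<^sup>2 - 2 * inv_pair p k)"
    using sum_split_reflect[of "\<lambda>k. (1 / of_nat k)\<^sup>2 :: rat" h] *
    by (simp add: p_eq del: of_nat_add)
  then show ?thesis
    by (simp add: coeff_1_prod_linear sum_distrib_left sum_subtractf)
qed

text \<open>Index pairs of the form \<open>k\<close>, \<open>p - k\<close> contribute
  \<open>esym 1\<close>; the four products between two different such pairs combine to
  \<open>p^2\<close> times a product of two \<open>inv_pair\<close> values. Power sums give this
  without splitting the index set.\<close>

lemma sum_pairs_inverse_eq:
  "(\<Sum>(i, j) \<in> {(i, j). 1 \<le> i \<and> i < j \<and> j \<le> p - 1}. 1 / (of_nat i * of_nat j))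
    = (of_nat p)\<^sup>2 * esym 2 + esym 1"
proof -
  let ?S = "\<Sum>(i, j) \<in> {(i, j). 1 \<le> i \<and> i < j \<and> j \<le> p - 1}. 1 / (of_nat i * of_nat j) :: rat"
  have "2 * ?S = (of_nat p * esym 1)\<^sup>2
    - ((of_nat p)\<^sup>2 * (\<Sum>k = 1..h. (inv_pair p k)\<^sup>2) - 2 * esym 1)"
    using sum_pairs_less[of "\<lambda>k. 1 / of_nat k :: rat" "p - 1"]
    unfolding sum_inverse_eq sum_inverse_square_eq by simp
  also have "\<dots> = (of_nat p)\<^sup>2 * ((esym 1)\<^sup>2 - (\<Sum>k = 1..h. (inv_pair p k)\<^sup>2)) + 2 * esym 1"
    by (simp add: algebra_simps power_mult_distrib)
  also have "(esym 1)\<^sup>2 - (\<Sum>k = 1..h. (inv_pair p k)\<^sup>2) = 2 * esym 2"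
    using coeff_2_prod_linear[of "{1..h}" "inv_pair p"]
    by (simp add: coeff_1_prod_linear numeral_2_eq_2)
  finally show ?thesis
    by simp
qed

lemma gbinomial_eq_poly:
  "(\<alpha> * of_nat p - 1) gchoose (p - 1)
    = poly (\<Prod>k = 1..h. [:1, inv_pair p k:]) ((\<alpha>\<^sup>2 - \<alpha>) * (of_nat p)\<^sup>2)"
proof -
  have *: "(1 - \<alpha> * of_nat p / of_nat k) * (1 - \<alpha> * of_nat p / of_nat (p - k))
    = 1 + (\<alpha>\<^sup>2 - \<alpha>) * (of_nat p)\<^sup>2 * inv_pair p k" if "k \<in> {1..h}" for k
  proof -
    have "(1 - \<alpha> * of_nat p / of_nat k) * (1 - \<alpha> * of_nat p / of_nat (p - k))
      = 1 - \<alpha> * of_nat p * (1 / of_nat k + 1 / of_nat (p - k))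
        + \<alpha>\<^sup>2 * (of_nat p)\<^sup>2 * inv_pair p k"
      by (simp add: inv_pair_def power2_eq_square algebra_simps diff_divide_distrib)
    also have "\<dots> = 1 + (\<alpha>\<^sup>2 - \<alpha>) * (of_nat p)\<^sup>2 * inv_pair p k"
      unfolding inverse_add_reflect[OF that] by (simp add: power2_eq_square algebra_simps)
    finally show ?thesis .
  qed
  \<comment> \<open>The sign disappears because \<open>p - 1 = 2 * h\<close> is even.\<close>
  have "(\<alpha> * of_nat p - 1) gchoose (p - 1) = (\<Prod>k = 1..2 * h. 1 - \<alpha> * of_nat p / of_nat k)"
    by (simp add: gbinomial_pred_eq_prod p_eq)
  also have "\<dots> = (\<Prod>k = 1..h. (1 - \<alpha> * of_nat p / of_nat k) * (1 - \<alpha> * of_nat p / of_nat (p - k)))"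
    using prod_split_reflect[of "\<lambda>k. 1 - \<alpha> * of_nat p / of_nat k" h] by (simp only: p_eq)
  also have "\<dots> = (\<Prod>k = 1..h. 1 + (\<alpha>\<^sup>2 - \<alpha>) * (of_nat p)\<^sup>2 * inv_pair p k)"
    using * by (rule prod.cong[OF refl])
  finally show ?thesis
    by (simp add: poly_prod)
qed

end

section \<open>Comparison of the two expansions\<close>

theorem theorem1:
  fixes p :: nat and \<alpha> :: rat
  assumes "prime p" and "odd p" and "p_integral p \<alpha>"
  shows "rat_cong_ppow p (if p = 7 then 6 else 7)
    ((\<alpha> * of_nat p - 1) gchoose (p - 1))
    (1 - \<alpha> * (\<alpha> - 1) * (\<alpha>\<^sup>2 - \<alpha> - 1) * of_nat p * (\<Sum>k = 1..p - 1. 1 / of_nat k)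
       + \<alpha>\<^sup>2 * (\<alpha> - 1)\<^sup>2 * (of_nat p)\<^sup>2
         * (\<Sum>(i, j) \<in> {(i, j). 1 \<le> i \<and> i < j \<and> j \<le> p - 1}. 1 / (of_nat i * of_nat j)))"
proof -
  obtain h where h: "p = 2 * h + 1"
    using \<open>odd p\<close> by (elim oddE)
  note ints = p_integral_intros[OF \<open>prime p\<close>]
  define E where "E n = coeff (\<Prod>k = 1..h. [:1, inv_pair p k:]) n" for n
  define t where "t = \<alpha>\<^sup>2 - \<alpha>"
  define P where "P = (of_nat p :: rat)"
  have P0: "P \<noteq> 0"
    using h by (simp add: P_def)
  have int_E: "p_integral p (E n)" for n
    unfolding E_def
    by (intro p_integral_coeff_prod_linear p_integral_inv_pair[OF \<open>prime p\<close> h] \<open>prime p\<close>)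
  have int_t: "p_integral p t"
    unfolding t_def by (intro ints assms)
  have int_P: "p_integral p P"
    unfolding P_def by (intro ints)
  let ?L = "(\<alpha> * of_nat p - 1) gchoose (p - 1)"
  let ?R = "1 - \<alpha> * (\<alpha> - 1) * (\<alpha>\<^sup>2 - \<alpha> - 1) * of_nat p * (\<Sum>k = 1..p - 1. 1 / of_nat k)
    + \<alpha>\<^sup>2 * (\<alpha> - 1)\<^sup>2 * (of_nat p)\<^sup>2
      * (\<Sum>(i, j) \<in> {(i, j). 1 \<le> i \<and> i < j \<and> j \<le> p - 1}. 1 / (of_nat i * of_nat j))"
  have L: "?L = poly (\<Prod>k = 1..h. [:1, inv_pair p k:]) (t * P\<^sup>2)"
    using gbinomial_eq_poly[OF \<open>prime p\<close> h] by (simp add: t_def P_def)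
  have "p_integral p (t * P\<^sup>2)"
    by (intro ints int_t int_P)
  with int_E obtain r where r: "p_integral p r" and expand:
    "?L = E 0 + t * P\<^sup>2 * E 1 + (t * P\<^sup>2)\<^sup>2 * E 2 + (t * P\<^sup>2) ^ 3 * E 3 + (t * P\<^sup>2) ^ 4 * r"
    using poly_remainder_4[OF \<open>prime p\<close>, of "\<Prod>k = 1..h. [:1, inv_pair p k:]" "t * P\<^sup>2"]
    unfolding L E_def by (auto simp: numeral_2_eq_2 numeral_3_eq_3)
  have "?R = 1 - t * (t - 1) * P * (P * E 1) + t\<^sup>2 * P\<^sup>2 * (P\<^sup>2 * E 2 + E 1)"
    unfolding sum_inverse_eq[OF \<open>prime p\<close> h] sum_pairs_inverse_eq[OF \<open>prime p\<close> h]
    by (simp add: E_def t_def P_def power2_eq_square algebra_simps)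
  \<comment> \<open>Both sums contribute to \<open>E 1\<close>, with total coefficient
    \<open>P^2 * (t^2 - t * (t - 1)) = t * P^2\<close>.\<close>
  then have R: "?R = 1 + t * P\<^sup>2 * E 1 + (t * P\<^sup>2)\<^sup>2 * E 2"
    by (simp add: power2_eq_square algebra_simps)
  have "E 0 = 1"
    unfolding E_def by (rule coeff_0_prod_linear)
  with expand R have diff: "?L - ?R = P ^ 6 * (t ^ 3 * E 3 + P\<^sup>2 * t ^ 4 * r)"
    by (simp add: algebra_simps eval_nat_numeral)
  have "p_integral p ((?L - ?R) / P ^ (if p = 7 then 6 else 7))"
  proof (cases "p = 7")
    case True
    have "p_integral p (t ^ 3 * E 3 + P\<^sup>2 * t ^ 4 * r)"
      by (intro ints int_t int_E int_P r)
    with True P0 show ?thesis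
      unfolding diff by simp
  next
    case False
    then have "p_integral p (E 3 / P)"
      using esym_3_dvd[OF \<open>prime p\<close> h] by (simp add: E_def P_def)
    \<comment> \<open>The seventh power of \<open>P\<close> takes one factor from
      \<open>E 3\<close>, while the tail, a multiple of \<open>P ^ 8\<close>, still has one to
      spare.\<close>
    then have "p_integral p (t ^ 3 * (E 3 / P) + P * t ^ 4 * r)"
      by (intro ints int_t int_P r)
    also have "t ^ 3 * (E 3 / P) + P * t ^ 4 * r
      = (P ^ 6 * (t ^ 3 * E 3 + P\<^sup>2 * t ^ 4 * r)) / P ^ 7"
      using P0 by (simp add: field_simps eval_nat_numeral)
    finally show ?thesis
      using False unfolding diff by simp
  qed
  moreover have "p_integral p ?L"
    unfolding expand by (intro ints int_t int_E int_P r)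
  moreover have "p_integral p ?R"
    unfolding R by (intro ints int_t int_E int_P)
  ultimately show ?thesis
    unfolding rat_cong_ppow_def P_def by blast
qed

end
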